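(* Let $\mathcal{G}$ be a graph with $n$ vertices, maximum degree $\Delta$, and $t$ triangles. Then $$M(\mathcal{G})\ge n+\binom{\Delta}{2}+t.$$
   Context: Graphs are finite, simple and undirected. A triangle is a set of three pairwise adjacent vertices. For a graph $\mathcal{G}$ with $n$ vertices and adjacency matrix $A$, viewed over $\mathbb{F}_2$, let $C(\mathcal{G})\subseteq\mathbb{F}_2^{2n}$ be the binary linear code generated by the rows of $[I_n|A]$, where $I_n$ is the $n\times n$ identity matrix. The support of a vector is the set of positions of its nonzero entries. A nonzero codeword $c$ of a binary linear code $C$ is minimal if there is no nonzero codeword $c'\in C$ with $\operatorname{supp}(c')\subsetneq\operatorname{supp}(c)$. $M(\mathcal{G})$ denotes the number of minimal codewords of $C(\mathcal{G})$; it does not depend on the labeling of the vertices. *)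

theory Defs
  imports
    "HOL-Library.Z2"
    "Graph_Theory.Pair_Digraph"
    "Jordan_Normal_Form.VS_Connect"
begin

text \<open>
  A finite simple undirected graph is a \<^locale>\<open>pair_graph\<close>: a finite vertex set with a finite
  symmetric irreflexive set of ordered pairs. Hence the degree of a vertex is its
  \<^const>\<open>out_degree\<close>. The field with two elements is the type \<^typ>\<open>bit\<close>.
\<close>

text \<open>Inserting 0 only matters for the graph without vertices, whose maximum degree is taken to be 0.\<close>

definition max_degree :: "'a pair_pre_digraph \<Rightarrow> nat" where
  "max_degree G = Max (insert 0 (out_degree (with_proj G) ` pverts G))"

definition triangles :: "'a pair_pre_digraph \<Rightarrow> 'a set set" where
  "triangles G = {T. T \<subseteq> pverts G \<and> card T = 3 \<and>
     (\<forall>u\<in>T. \<forall>v\<in>T. u \<noteq> v \<longrightarrow> u \<rightarrow>\<^bsub>with_proj G\<^esub> v)}"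

definition labeling :: "'a pair_pre_digraph \<Rightarrow> (nat \<Rightarrow> 'a) \<Rightarrow> bool" where
  "labeling G l \<longleftrightarrow> bij_betw l {0..<card (pverts G)} (pverts G)"

definition adjacency_matrix :: "'a pair_pre_digraph \<Rightarrow> (nat \<Rightarrow> 'a) \<Rightarrow> bit mat" where
  "adjacency_matrix G l = mat (card (pverts G)) (card (pverts G))
     (\<lambda>(i, j). if l i \<rightarrow>\<^bsub>with_proj G\<^esub> l j then 1 else 0)"

text \<open>The block matrix with \<open>I\<close> on the left and the adjacency matrix on the right; the two lower blocks have no rows.\<close>

definition generator_matrix :: "'a pair_pre_digraph \<Rightarrow> (nat \<Rightarrow> 'a) \<Rightarrow> bit mat" where
  "generator_matrix G l = (let n = card (pverts G) in
     four_block_mat (1\<^sub>m n) (adjacency_matrix G l) (0\<^sub>m 0 n) (0\<^sub>m 0 n))"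

definition graph_code :: "'a pair_pre_digraph \<Rightarrow> (nat \<Rightarrow> 'a) \<Rightarrow> bit vec set" where
  "graph_code G l = vec_space.row_space (2 * card (pverts G)) (generator_matrix G l)"

definition vec_supp :: "'b::zero vec \<Rightarrow> nat set" where
  "vec_supp c = {i. i < dim_vec c \<and> c $ i \<noteq> 0}"

definition minimal_codewords :: "bit vec set \<Rightarrow> bit vec set" where
  "minimal_codewords C = {c \<in> C. c \<noteq> 0\<^sub>v (dim_vec c) \<and>
     \<not> (\<exists>c'\<in>C. c' \<noteq> 0\<^sub>v (dim_vec c') \<and> vec_supp c' \<subset> vec_supp c)}"

text \<open>
  The number of minimal codewords of the code of \<open>G\<close>. Its value is the same for every
  labeling \<open>l\<close> of the vertices; the labeling is kept as an explicit argument.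
\<close>

definition num_minimal_codewords :: "'a pair_pre_digraph \<Rightarrow> (nat \<Rightarrow> 'a) \<Rightarrow> nat" where
  "num_minimal_codewords G l = card (minimal_codewords (graph_code G l))"

end

theory Submission
  imports Defs
begin

text \<open>
  A codeword of the code of \<open>G\<close> is a sum of generator rows, hence determined by the set \<open>S\<close> of
  vertices whose rows are added. Its left half is the indicator vector of \<open>S\<close>, its right half the
  indicator vector of the set \<open>odd_nbhd G S\<close> of vertices with an odd number of neighbours in \<open>S\<close>.
  So inclusion of supports means inclusion both of the vertex sets and of their odd
  neighbourhoods, and the codeword of a nonempty \<open>S\<close> is minimal as soon as no nonempty \<open>T \<subset> S\<close>
  satisfies \<open>odd_nbhd G T \<subseteq> odd_nbhd G S\<close> (lemma \<open>codeword_minimalI\<close>).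

  This criterion applies to two kinds of vertex sets. If \<open>S\<close> is a clique of odd size, then every
  vertex of \<open>S\<close> has evenly many neighbours in \<open>S\<close>, whereas for a nonempty \<open>T \<subset> S\<close> some vertex of
  \<open>S\<close> has an odd number of neighbours in \<open>T\<close>: a vertex of \<open>T\<close> if \<open>card T\<close> is even, a vertex
  of \<open>S - T\<close> if it is odd (lemma \<open>odd_clique_minimal\<close>). If \<open>S = {u, v}\<close> and \<open>u\<close>, \<open>v\<close> have a common
  neighbour \<open>w\<close>, then \<open>w\<close> is in the odd neighbourhood of \<open>{u}\<close> and of \<open>{v}\<close> but not in that
  of \<open>S\<close> (lemma \<open>common_neighbour_minimal\<close>). The \<open>n\<close> singletons and the \<open>t\<close> triangles are odd
  cliques, and the pairs of neighbours of a vertex of degree \<open>\<Delta>\<close> have that vertex as a common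
  neighbour. These three families are disjoint since their members have sizes 1, 3 and 2.
\<close>

section \<open>Codewords as vertex sets\<close>

text \<open>The vertices with an odd number of neighbours in \<open>S\<close>.\<close>

definition odd_nbhd :: "'a pair_pre_digraph \<Rightarrow> 'a set \<Rightarrow> 'a set" where
  "odd_nbhd G S = {v \<in> pverts G. odd (card {u \<in> S. (u, v) \<in> parcs G})}"

text \<open>
  The sum of the generator rows that belong to the vertices in \<open>S\<close>, given by its coordinates:
  position \<open>k\<close> of either half belongs to the vertex \<open>l k\<close>. That it is this sum is shown in
  \<open>generator_matrix_mult_indicator\<close> below, which needs \<open>S\<close> to consist of vertices of \<open>G\<close>.
\<close>

definition codeword :: "'a pair_pre_digraph \<Rightarrow> (nat \<Rightarrow> 'a) \<Rightarrow> 'a set \<Rightarrow> bit vec" where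
  "codeword G l S = vec (2 * card (pverts G))
     (\<lambda>k. if k < card (pverts G) then of_bool (l k \<in> S)
          else of_bool (l (k - card (pverts G)) \<in> odd_nbhd G S))"

lemma of_nat_bit: "(of_nat k :: bit) = of_bool (odd k)"
  by (induction k) auto

lemma generator_matrix_carrier:
  "generator_matrix G l \<in> carrier_mat (card (pverts G)) (2 * card (pverts G))"
  by (rule carrier_matI) (simp_all add: generator_matrix_def adjacency_matrix_def Let_def)

lemma generator_matrix_index:
  assumes "i < card (pverts G)" "k < 2 * card (pverts G)"
  shows "generator_matrix G l $$ (i, k) =
    (if k < card (pverts G) then of_bool (i = k)
     else of_bool ((l i, l (k - card (pverts G))) \<in> parcs G))"
  using assms
  by (auto simp: generator_matrix_def adjacency_matrix_def Let_def)

lemma generator_matrix_mult_indicator: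
  assumes l: "labeling G l" and S: "S \<subseteq> pverts G"
  shows "(generator_matrix G l)\<^sup>T *\<^sub>v vec (card (pverts G)) (\<lambda>i. of_bool (l i \<in> S)) = codeword G l S"
    (is "?M\<^sup>T *\<^sub>v ?y = _")
proof (rule eq_vecI)
  let ?n = "card (pverts G)"
  have dims: "dim_row ?M = ?n" "dim_col ?M = 2 * ?n"
    using generator_matrix_carrier[of G l] by auto
  show "dim_vec (?M\<^sup>T *\<^sub>v ?y) = dim_vec (codeword G l S)"
    by (simp add: codeword_def dims)
  fix k assume "k < dim_vec (codeword G l S)"
  then have k: "k < 2 * ?n" by (simp add: codeword_def)
  have bij: "bij_betw l {0..<?n} (pverts G)"
    using l by (simp add: labeling_def)
  have "(?M\<^sup>T *\<^sub>v ?y) $ k = (\<Sum>i = 0..<?n. ?M $$ (i, k) * of_bool (l i \<in> S))"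
    using k by (simp add: dims scalar_prod_def)
  also have "\<dots> = codeword G l S $ k"
  proof (cases "k < ?n")
    case True
    have "(\<Sum>i = 0..<?n. ?M $$ (i, k) * of_bool (l i \<in> S))
        = (\<Sum>i = 0..<?n. if i = k then of_bool (l k \<in> S) else 0)"
      using k True by (intro sum.cong) (auto simp: generator_matrix_index)
    then show ?thesis using True k by (simp add: codeword_def)
  next
    case False
    let ?w = "l (k - ?n)"
    have w: "?w \<in> pverts G"
      using bij_betwE[OF bij] k False by auto
    have fin: "finite (pverts G)"
      using bij bij_betw_finite by blast
    have "(\<Sum>i = 0..<?n. ?M $$ (i, k) * of_bool (l i \<in> S))
        = (\<Sum>i = 0..<?n. of_bool (l i \<in> S \<and> (l i, ?w) \<in> parcs G))"
      using k False by (intro sum.cong) (auto simp: generator_matrix_index)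
    also have "\<dots> = (\<Sum>u\<in>pverts G. of_bool (u \<in> S \<and> (u, ?w) \<in> parcs G))"
      by (rule sum.reindex_bij_betw[OF bij])
    also have "\<dots> = of_nat (card (pverts G \<inter> {u. u \<in> S \<and> (u, ?w) \<in> parcs G}))"
      using fin by (simp add: sum_of_bool_eq)
    also have "pverts G \<inter> {u. u \<in> S \<and> (u, ?w) \<in> parcs G} = {u \<in> S. (u, ?w) \<in> parcs G}"
      using S by auto
    finally show ?thesis
      using k False w by (simp add: codeword_def odd_nbhd_def of_nat_bit)
  qed
  finally show "(?M\<^sup>T *\<^sub>v ?y) $ k = codeword G l S $ k" .
qed

lemma graph_code_eq:
  assumes l: "labeling G l"
  shows "graph_code G l = codeword G l ` Pow (pverts G)"
proof -
  let ?n = "card (pverts G)"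
  let ?M = "generator_matrix G l"
  have dims: "dim_row ?M = ?n" "dim_col ?M = 2 * ?n"
    using generator_matrix_carrier[of G l] by auto
  have bij: "bij_betw l {0..<?n} (pverts G)"
    using l by (simp add: labeling_def)
  have code: "graph_code G l = {w \<in> carrier_vec (2 * ?n). \<exists>y\<in>carrier_vec ?n. ?M\<^sup>T *\<^sub>v y = w}"
    unfolding graph_code_def
    using vec_space.row_space_eq[OF generator_matrix_carrier[of G l]] by (simp add: dims)
  show ?thesis
  proof (intro equalityI subsetI)
    fix c assume "c \<in> graph_code G l"
    then obtain y where y: "y \<in> carrier_vec ?n" "c = ?M\<^sup>T *\<^sub>v y"
      unfolding code by blast
    define S where "S = l ` {i. i < ?n \<and> y $ i = 1}"
    have S: "S \<subseteq> pverts G"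
      using bij_betwE[OF bij] by (auto simp: S_def)
    have mem: "l i \<in> S \<longleftrightarrow> y $ i = 1" if "i < ?n" for i
    proof
      assume "l i \<in> S"
      then obtain j where j: "j < ?n" "y $ j = 1" "l i = l j" by (auto simp: S_def)
      then have "i = j"
        using inj_onD[OF bij_betw_imp_inj_on[OF bij], of i j] that by simp
      then show "y $ i = 1" using j(2) by simp
    next
      assume "y $ i = 1"
      then show "l i \<in> S" using that by (auto simp: S_def)
    qed
    have "y = vec ?n (\<lambda>i. of_bool (l i \<in> S))"
    proof (rule eq_vecI)
      fix i assume "i < dim_vec (vec ?n (\<lambda>i. of_bool (l i \<in> S) :: bit))"
      then show "y $ i = vec ?n (\<lambda>i. of_bool (l i \<in> S)) $ i"
        using mem[of i] by (cases "y $ i") simp_all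
    qed (use y(1) in simp)
    then show "c \<in> codeword G l ` Pow (pverts G)"
      using generator_matrix_mult_indicator[OF l S] S y(2) by auto
  next
    fix c assume "c \<in> codeword G l ` Pow (pverts G)"
    then obtain S where S: "S \<subseteq> pverts G" "c = codeword G l S" by auto
    then have "?M\<^sup>T *\<^sub>v vec ?n (\<lambda>i. of_bool (l i \<in> S)) = c"
      using generator_matrix_mult_indicator[OF l] by simp
    moreover have "c \<in> carrier_vec (2 * ?n)"
      by (simp add: S(2) codeword_def)
    ultimately show "c \<in> graph_code G l"
      unfolding code by auto
  qed
qed

lemma vec_supp_codeword_subset:
  assumes l: "labeling G l" and T: "T \<subseteq> pverts G"
    and sub: "vec_supp (codeword G l T) \<subseteq> vec_supp (codeword G l S)"
  shows "T \<subseteq> S" and "odd_nbhd G T \<subseteq> odd_nbhd G S"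
proof -
  let ?n = "card (pverts G)"
  have surj: "\<exists>i<?n. v = l i" if "v \<in> pverts G" for v
    using l that by (force simp: labeling_def bij_betw_def)
  show "T \<subseteq> S"
  proof
    fix v assume v: "v \<in> T"
    then obtain i where i: "i < ?n" "v = l i" using surj T by auto
    then have "i \<in> vec_supp (codeword G l T)"
      using v by (simp add: vec_supp_def codeword_def)
    with sub have "i \<in> vec_supp (codeword G l S)" by auto
    then show "v \<in> S" using i by (simp add: vec_supp_def codeword_def split: if_splits)
  qed
  show "odd_nbhd G T \<subseteq> odd_nbhd G S"
  proof
    fix v assume v: "v \<in> odd_nbhd G T"
    then obtain i where i: "i < ?n" "v = l i"
      using surj by (auto simp: odd_nbhd_def)
    then have "?n + i \<in> vec_supp (codeword G l T)"
      using v by (simp add: vec_supp_def codeword_def)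
    with sub have "?n + i \<in> vec_supp (codeword G l S)" by auto
    then show "v \<in> odd_nbhd G S" using i by (simp add: vec_supp_def codeword_def)
  qed
qed

lemma inj_on_codeword:
  assumes "labeling G l"
  shows "inj_on (codeword G l) (Pow (pverts G))"
proof (rule inj_onI)
  fix S T assume "S \<in> Pow (pverts G)" "T \<in> Pow (pverts G)" "codeword G l S = codeword G l T"
  then show "S = T"
    using vec_supp_codeword_subset(1)[OF assms, of S T] vec_supp_codeword_subset(1)[OF assms, of T S]
    by auto
qed

section \<open>Vertex sets with minimal codewords\<close>

lemma codeword_minimalI:
  assumes l: "labeling G l" and S: "S \<subseteq> pverts G" "S \<noteq> {}"
    and min: "\<And>T. T \<noteq> {} \<Longrightarrow> T \<subset> S \<Longrightarrow> \<not> odd_nbhd G T \<subseteq> odd_nbhd G S"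
  shows "codeword G l S \<in> minimal_codewords (graph_code G l)"
proof -
  let ?n = "card (pverts G)"
  have zero: "codeword G l {} = 0\<^sub>v (2 * ?n)"
    by (auto simp: codeword_def odd_nbhd_def)
  have "codeword G l S \<noteq> codeword G l {}"
    using inj_onD[OF inj_on_codeword[OF l], of S "{}"] S by auto
  then have "codeword G l S \<noteq> 0\<^sub>v (dim_vec (codeword G l S))"
    unfolding zero by (simp add: codeword_def)
  moreover have "codeword G l S \<in> graph_code G l"
    using S by (auto simp: graph_code_eq[OF l])
  moreover have False
    if c: "c \<in> graph_code G l" "c \<noteq> 0\<^sub>v (dim_vec c)" "vec_supp c \<subset> vec_supp (codeword G l S)" for c
  proof -
    obtain T where T: "T \<subseteq> pverts G" "c = codeword G l T"
      using c(1) by (auto simp: graph_code_eq[OF l])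
    have "T \<noteq> {}"
      using c(2) zero T(2) by auto
    moreover have "T \<noteq> S" using c(3) T(2) by auto
    ultimately show False
      using min[of T] vec_supp_codeword_subset[OF l T(1), of S] c(3) T(2) by auto
  qed
  ultimately show ?thesis
    unfolding minimal_codewords_def by blast
qed

lemma odd_clique_minimal:
  assumes G: "pair_graph G" and l: "labeling G l"
    and S: "S \<subseteq> pverts G" "odd (card S)"
    and clique: "\<And>u v. u \<in> S \<Longrightarrow> v \<in> S \<Longrightarrow> u \<noteq> v \<Longrightarrow> (u, v) \<in> parcs G"
  shows "codeword G l S \<in> minimal_codewords (graph_code G l)"
proof (rule codeword_minimalI[OF l S(1)])
  interpret pair_graph G by (rule G)
  have fin: "finite S" using S(2) card.infinite by fastforce
  show "S \<noteq> {}" using S(2) by auto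
  fix T assume T: "T \<noteq> {}" "T \<subset> S"
  have nbrs: "{u \<in> U. (u, v) \<in> parcs G} = U - {v}" if "U \<subseteq> S" "v \<in> S" for U v
    using that clique pair_no_loops[of "(v, v)"] by auto
  have finT: "finite T" using T fin finite_subset by blast
  obtain v where v: "v \<in> S" "odd (card (T - {v}))"
  proof (cases "odd (card T)")
    case True
    moreover obtain v where "v \<in> S - T" using T by auto
    ultimately show thesis using that[of v] by simp
  next
    case False
    moreover obtain v where "v \<in> T" using T by auto
    moreover from this have "card T \<noteq> 0" using finT by auto
    ultimately show thesis using that[of v] T finT by auto
  qed
  have "v \<in> odd_nbhd G T"
    using v T S(1) nbrs[of T v] by (auto simp: odd_nbhd_def)
  moreover have "v \<notin> odd_nbhd G S"
    using v S fin nbrs[of S v] by (simp add: odd_nbhd_def)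
  ultimately show "\<not> odd_nbhd G T \<subseteq> odd_nbhd G S" by blast
qed

lemma common_neighbour_minimal:
  assumes l: "labeling G l" and uv: "u \<in> pverts G" "v \<in> pverts G" "u \<noteq> v"
    and w: "w \<in> pverts G" "(u, w) \<in> parcs G" "(v, w) \<in> parcs G"
  shows "codeword G l {u, v} \<in> minimal_codewords (graph_code G l)"
proof (rule codeword_minimalI[OF l])
  show "{u, v} \<subseteq> pverts G" "{u, v} \<noteq> {}" using uv by auto
  fix T assume "T \<noteq> {}" "T \<subset> {u, v}"
  then have "T = {u} \<or> T = {v}" by auto
  moreover have "{x \<in> {u, v}. (x, w) \<in> parcs G} = {u, v}"
    "{x \<in> {u}. (x, w) \<in> parcs G} = {u}" "{x \<in> {v}. (x, w) \<in> parcs G} = {v}"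
    using w by auto
  ultimately have "w \<in> odd_nbhd G T" "w \<notin> odd_nbhd G {u, v}"
    using w(1) uv(3) by (auto simp: odd_nbhd_def)
  then show "\<not> odd_nbhd G T \<subseteq> odd_nbhd G {u, v}" by blast
qed

section \<open>The lower bound\<close>

text \<open>
  The set \<open>N\<close> is the neighbourhood of a vertex of maximum degree, or empty if the maximum degree
  is 0, which covers the graph without vertices.
\<close>

lemma max_degree_neighbourhood:
  assumes "pair_graph G"
  obtains N where "N \<subseteq> pverts G" "card N = max_degree G"
    "\<And>u v. u \<in> N \<Longrightarrow> v \<in> N \<Longrightarrow> \<exists>w\<in>pverts G. (u, w) \<in> parcs G \<and> (v, w) \<in> parcs G"
proof -
  interpret pair_graph G by (rule assms)
  have "max_degree G \<in> insert 0 (out_degree (with_proj G) ` pverts G)"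
    unfolding max_degree_def using pair_finite_verts by (intro Max_in) auto
  then consider "max_degree G = 0"
    | w where "w \<in> pverts G" "max_degree G = out_degree (with_proj G) w" by auto
  then show thesis
  proof cases
    case 1
    then show thesis using that[of "{}"] by simp
  next
    case 2
    let ?N = "{u. (w, u) \<in> parcs G}"
    have "out_arcs (with_proj G) w = Pair w ` ?N"
      by (auto simp: out_arcs_def)
    then have "card ?N = max_degree G"
      by (simp add: 2(2) out_degree_def card_image inj_on_def)
    moreover have "?N \<subseteq> pverts G" using in_arcsD2 by auto
    ultimately show thesis
      using that[of ?N] 2(1) arcs_symmetric by blast
  qed
qed

theorem lemma3p12:
  fixes G :: "'a pair_pre_digraph" and l :: "nat \<Rightarrow> 'a" and n \<Delta> t :: nat
  assumes "pair_graph G"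
    and "labeling G l"
    and "card (pverts G) = n"
    and "max_degree G = \<Delta>"
    and "card (triangles G) = t"
  shows "num_minimal_codewords G l \<ge> n + (\<Delta> choose 2) + t"
proof -
  interpret pair_graph G by (rule assms(1))
  note G = assms(1) and l = assms(2)
  let ?C = "minimal_codewords (graph_code G l)"
  have fin: "finite (pverts G)" by (rule pair_finite_verts)
  obtain N where N: "N \<subseteq> pverts G" "card N = \<Delta>"
    "\<And>u v. u \<in> N \<Longrightarrow> v \<in> N \<Longrightarrow> \<exists>w\<in>pverts G. (u, w) \<in> parcs G \<and> (v, w) \<in> parcs G"
    using max_degree_neighbourhood[OF G] assms(4) by metis
  define A where "A = (\<lambda>v. {v}) ` pverts G"
  define P where "P = {S. S \<subseteq> N \<and> card S = 2}"
  have sizes: "\<And>S. S \<in> A \<Longrightarrow> card S = 1" "\<And>S. S \<in> P \<Longrightarrow> card S = 2"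
    "\<And>S. S \<in> triangles G \<Longrightarrow> card S = 3"
    by (auto simp: A_def P_def triangles_def)
  have sub: "A \<union> P \<union> triangles G \<subseteq> Pow (pverts G)"
    using N(1) by (auto simp: A_def P_def triangles_def)
  have "finite (A \<union> P \<union> triangles G)"
    using sub fin finite_subset by blast
  then have finite: "finite A" "finite P" "finite (triangles G)" by auto
  have "A \<inter> P = {}" "(A \<union> P) \<inter> triangles G = {}"
    using sizes by fastforce+
  moreover have "card A = n"
    using assms(3) by (simp add: A_def card_image)
  moreover have "card P = \<Delta> choose 2"
    using n_subsets[OF finite_subset[OF N(1) fin], of 2] N(2) by (simp add: P_def)
  ultimately have "n + (\<Delta> choose 2) + t = card (A \<union> P \<union> triangles G)"
    using finite assms(5) by (simp add: card_Un_disjoint)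
  also have "\<dots> = card (codeword G l ` (A \<union> P \<union> triangles G))"
    using inj_on_subset[OF inj_on_codeword[OF l] sub] by (rule card_image[symmetric])
  also have "\<dots> \<le> card ?C"
  proof (rule card_mono)
    have "?C \<subseteq> codeword G l ` Pow (pverts G)"
      by (auto simp: minimal_codewords_def graph_code_eq[OF l])
    then show "finite ?C" using fin finite_subset by blast
    have "codeword G l S \<in> ?C" if "S \<in> A" for S
      using that by (auto simp: A_def intro!: odd_clique_minimal[OF G l])
    moreover have "codeword G l S \<in> ?C" if "S \<in> triangles G" for S
      using that by (intro odd_clique_minimal[OF G l]) (auto simp: triangles_def)
    moreover have "codeword G l S \<in> ?C" if S: "S \<in> P" for S
    proof -
      obtain u v where uv: "S = {u, v}" "u \<noteq> v"
        using S by (auto simp: P_def card_2_iff)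
      then have "u \<in> N" "v \<in> N" using S by (auto simp: P_def)
      then show ?thesis
        using common_neighbour_minimal[OF l] N(1,3) uv by blast
    qed
    ultimately show "codeword G l ` (A \<union> P \<union> triangles G) \<subseteq> ?C" by blast
  qed
  finally show ?thesis by (simp add: num_minimal_codewords_def)
qed

end
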